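(* Let $S$ be a semigroup and $M$ a monoid with identity $1$, and suppose $S$ acts on the left of $M$ by monoid endomorphisms, with action written $s\cdot a$ for $s\in S$, $a\in M$. Let $M\rtimes S$ be the corresponding semidirect product. Suppose $S$ has semigroup presentation $\langle X : R\rangle$ via $\phi:X^+\to S$. Define the alphabet $X_M=\{x_a : x\in X,\ a\in M\}$, where $X$ is regarded as a subset of $X_M$ by identifying $x\in X$ with $x_1\in X_M$. For a word $w=x_1x_2\cdots x_k\in X^+$ (with $x_1,\ldots,x_k\in X$) and $a\in M$, let $w_a=(x_1)_a\,x_2\cdots x_k\in X_M^+$. Let $R_M=R_M^1\cup R_M^2$, where $$R_M^1=\{(u_a,v_a) : (u,v)\in R,\ a\in M\},\qquad R_M^2=\{(x_ay_b,\ x_{a(x\phi\cdot b)}\,y) : x,y\in X,\ a,b\in M\},$$ and let $\phi_M:X_M^+\to M\rtimes S$ be the homomorphism determined by $x_a\phi_M=(a,x\phi)$ for all $x\in X$, $a\in M$. Then $M\rtimes S$ has semigroup presentation $\langle X_M : R_M\rangle$ via $\phi_M$.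
   Context: Maps $\phi$ are written on the right of their arguments. A left action of $S$ on $M$ by monoid endomorphisms satisfies $s\cdot 1=1$, $s\cdot(t\cdot a)=(st)\cdot a$ and $s\cdot(ab)=(s\cdot a)(s\cdot b)$ for all $s,t\in S$, $a,b\in M$. (If $S$ happens to be a monoid, its identity is not assumed to act as the identity map.) The semidirect product $M\rtimes S$ is the set $M\times S$ with product $(a,s)(b,t)=(a(s\cdot b),st)$. For an alphabet $X$, $X^+$ is the free semigroup on $X$; for $R\subseteq X^+\times X^+$, $R^\sharp$ is the congruence on $X^+$ generated by $R$. A semigroup $T$ has semigroup presentation $\langle X:R\rangle$ via $\phi:X^+\to T$ if $\phi$ is a surjective homomorphism with kernel $\ker(\phi)=\{(u,v):u\phi=v\phi\}=R^\sharp$. *)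

theory Defs
  imports "HOL-Algebra.Group"
begin

(* The monoid record of HOL-Algebra has a unit field, which a semigroup lacks. *)
record 'a semigrp_struct = "'a partial_object" +
  sg_mult :: "'a \<Rightarrow> 'a \<Rightarrow> 'a"  (infixl "\<cdot>\<index>" 70)

locale semigrp =
  fixes S (structure)
  assumes sg_closed: "\<lbrakk>x \<in> carrier S; y \<in> carrier S\<rbrakk> \<Longrightarrow> x \<cdot> y \<in> carrier S"
    and sg_assoc: "\<lbrakk>x \<in> carrier S; y \<in> carrier S; z \<in> carrier S\<rbrakk>
      \<Longrightarrow> (x \<cdot> y) \<cdot> z = x \<cdot> (y \<cdot> z)"

definition sg_hom :: "('a, 'c) semigrp_struct_scheme \<Rightarrow> ('b, 'd) semigrp_struct_scheme \<Rightarrow> ('a \<Rightarrow> 'b) set" where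
  "sg_hom S T = {h \<in> carrier S \<rightarrow> carrier T.
     \<forall>x\<in>carrier S. \<forall>y\<in>carrier S. h (x \<cdot>\<^bsub>S\<^esub> y) = h x \<cdot>\<^bsub>T\<^esub> h y}"

definition sg_kernel :: "('a, 'c) semigrp_struct_scheme \<Rightarrow> ('a \<Rightarrow> 'b) \<Rightarrow> ('a \<times> 'a) set" where
  "sg_kernel S h = {(u, v). u \<in> carrier S \<and> v \<in> carrier S \<and> h u = h v}"

definition sg_congruence :: "('a, 'c) semigrp_struct_scheme \<Rightarrow> ('a \<times> 'a) set \<Rightarrow> bool" where
  "sg_congruence S \<rho> \<longleftrightarrow> equiv (carrier S) \<rho> \<and>
     (\<forall>(a, b)\<in>\<rho>. \<forall>(c, d)\<in>\<rho>. (a \<cdot>\<^bsub>S\<^esub> c, b \<cdot>\<^bsub>S\<^esub> d) \<in> \<rho>)"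

(* Only meaningful for R contained in carrier S \<times> carrier S; otherwise no congruence
   contains R and the intersection is UNIV. *)
definition sg_cong_gen :: "('a, 'c) semigrp_struct_scheme \<Rightarrow> ('a \<times> 'a) set \<Rightarrow> ('a \<times> 'a) set" where
  "sg_cong_gen S R = \<Inter>{\<rho>. sg_congruence S \<rho> \<and> R \<subseteq> \<rho>}"

lemma (in semigrp) sg_congruence_cong_gen:
  assumes "R \<subseteq> carrier S \<times> carrier S"
  shows "sg_congruence S (sg_cong_gen S R)"
proof -
  let ?U = "carrier S \<times> carrier S"
  have U: "sg_congruence S ?U"
    by (auto simp: sg_congruence_def equiv_def refl_on_def sym_on_def trans_on_def sg_closed)
  then have sub: "sg_cong_gen S R \<subseteq> ?U"
    using assms by (auto simp: sg_cong_gen_def)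
  have "equiv (carrier S) (sg_cong_gen S R)"
  proof (rule equivI)
    show "sg_cong_gen S R \<subseteq> ?U" by (rule sub)
    show "refl_on (carrier S) (sg_cong_gen S R)"
      by (auto simp: sg_cong_gen_def sg_congruence_def equiv_def refl_on_def)
    show "sym (sg_cong_gen S R)"
    proof (rule symI)
      fix x y
      assume xy: "(x, y) \<in> sg_cong_gen S R"
      have "(y, x) \<in> \<rho>" if "sg_congruence S \<rho>" "R \<subseteq> \<rho>" for \<rho>
      proof -
        have "sym \<rho>" using that(1) by (simp add: sg_congruence_def equiv_def)
        moreover have "(x, y) \<in> \<rho>" using xy that by (simp add: sg_cong_gen_def)
        ultimately show ?thesis by (rule symD)
      qed
      then show "(y, x) \<in> sg_cong_gen S R" by (simp add: sg_cong_gen_def)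
    qed
    show "trans (sg_cong_gen S R)"
    proof (rule transI)
      fix x y z
      assume xy: "(x, y) \<in> sg_cong_gen S R" and yz: "(y, z) \<in> sg_cong_gen S R"
      have "(x, z) \<in> \<rho>" if "sg_congruence S \<rho>" "R \<subseteq> \<rho>" for \<rho>
      proof -
        have "trans \<rho>" using that(1) by (simp add: sg_congruence_def equiv_def)
        moreover have "(x, y) \<in> \<rho>" "(y, z) \<in> \<rho>"
          using xy yz that by (auto simp: sg_cong_gen_def)
        ultimately show ?thesis by (rule transD)
      qed
      then show "(x, z) \<in> sg_cong_gen S R" by (simp add: sg_cong_gen_def)
    qed
  qed
  moreover have "(a \<cdot> c, b \<cdot> d) \<in> sg_cong_gen S R"
    if ab: "(a, b) \<in> sg_cong_gen S R" and cd: "(c, d) \<in> sg_cong_gen S R" for a b c d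
  proof -
    have "(a \<cdot> c, b \<cdot> d) \<in> \<rho>" if \<rho>: "sg_congruence S \<rho>" "R \<subseteq> \<rho>" for \<rho>
    proof -
      have "(a, b) \<in> \<rho>" "(c, d) \<in> \<rho>" using ab cd \<rho> by (auto simp: sg_cong_gen_def)
      moreover have "\<forall>(a, b)\<in>\<rho>. \<forall>(c, d)\<in>\<rho>. (a \<cdot> c, b \<cdot> d) \<in> \<rho>"
        using \<rho>(1) by (simp add: sg_congruence_def)
      ultimately show ?thesis by blast
    qed
    then show ?thesis by (simp add: sg_cong_gen_def)
  qed
  ultimately show ?thesis by (auto simp: sg_congruence_def)
qed

definition free_sg :: "'x set \<Rightarrow> 'x list semigrp_struct" where
  "free_sg X = \<lparr>carrier = {w. w \<noteq> [] \<and> set w \<subseteq> X}, sg_mult = (@)\<rparr>"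

(* The homomorphism from a free semigroup to T that sends each letter x to f x;
   its value on the empty word is irrelevant. *)
fun free_ext :: "('a, 'c) semigrp_struct_scheme \<Rightarrow> ('x \<Rightarrow> 'a) \<Rightarrow> 'x list \<Rightarrow> 'a" where
  "free_ext T f [] = undefined"
| "free_ext T f [x] = f x"
| "free_ext T f (x # y # w) = f x \<cdot>\<^bsub>T\<^esub> free_ext T f (y # w)"

definition sg_presentation ::
  "('a, 'c) semigrp_struct_scheme \<Rightarrow> 'x set \<Rightarrow> ('x list \<times> 'x list) set \<Rightarrow> ('x list \<Rightarrow> 'a) \<Rightarrow> bool" where
  "sg_presentation T X R \<phi> \<longleftrightarrow>
     R \<subseteq> carrier (free_sg X) \<times> carrier (free_sg X) \<and>
     \<phi> \<in> sg_hom (free_sg X) T \<and>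
     \<phi> ` carrier (free_sg X) = carrier T \<and>
     sg_kernel (free_sg X) \<phi> = sg_cong_gen (free_sg X) R"

lemma semigrp_free_sg: "semigrp (free_sg X)"
  by unfold_locales (auto simp: free_sg_def)

lemma (in semigrp) free_ext_hom:
  assumes "f ` X \<subseteq> carrier S"
  shows "free_ext S f \<in> sg_hom (free_sg X) S"
proof -
  have closed: "free_ext S f (x # w) \<in> carrier S" if "x \<in> X" "set w \<subseteq> X" for x w
    using that assms by (induction w arbitrary: x) (auto intro!: sg_closed)
  have app: "free_ext S f ((x # u) @ (y # v)) = free_ext S f (x # u) \<cdot> free_ext S f (y # v)"
    if "x \<in> X" "set u \<subseteq> X" "y \<in> X" "set v \<subseteq> X" for x u y v
    using that
  proof (induction u arbitrary: x)
    case (Cons z u)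
    moreover have "f x \<in> carrier S" using assms Cons.prems(1) by blast
    ultimately show ?case by (simp add: sg_assoc closed)
  qed simp
  have closed': "free_ext S f w \<in> carrier S" if "w \<in> carrier (free_sg X)" for w
    using that closed by (cases w) (simp_all add: free_sg_def)
  have app': "free_ext S f (u @ v) = free_ext S f u \<cdot> free_ext S f v"
    if u: "u \<in> carrier (free_sg X)" and v: "v \<in> carrier (free_sg X)" for u v
  proof -
    obtain x u' y v' where "u = x # u'" "v = y # v'"
      using u v by (cases u; cases v) (simp_all add: free_sg_def)
    then show ?thesis using u v app[of x u' y v'] by (simp add: free_sg_def)
  qed
  have "sg_mult (free_sg X) = (@)" by (simp add: free_sg_def)
  then show ?thesis using closed' app' by (simp add: sg_hom_def)
qed

lemma free_ext_unique:
  assumes "h \<in> sg_hom (free_sg X) T" and "\<And>x. x \<in> X \<Longrightarrow> h [x] = f x"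
    and "w \<in> carrier (free_sg X)"
  shows "h w = free_ext T f w"
proof -
  have app: "h (u @ v) = h u \<cdot>\<^bsub>T\<^esub> h v"
    if "u \<in> carrier (free_sg X)" "v \<in> carrier (free_sg X)" for u v
  proof -
    have "sg_mult (free_sg X) = (@)" by (simp add: free_sg_def)
    then show ?thesis using assms(1) that by (simp add: sg_hom_def)
  qed
  have "w \<noteq> []" "set w \<subseteq> X" using assms(3) by (simp_all add: free_sg_def)
  then show ?thesis
  proof (induction w rule: list_nonempty_induct)
    case (single x)
    then show ?case by (simp add: assms(2))
  next
    case (cons x w)
    then have "h ([x] @ w) = h [x] \<cdot>\<^bsub>T\<^esub> h w"
      by (intro app) (simp_all add: free_sg_def)
    moreover have "h [x] = f x" using cons.prems by (simp add: assms(2))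
    moreover have "h w = free_ext T f w" using cons by simp
    moreover obtain y v where "w = y # v" using cons.hyps by (cases w) simp_all
    ultimately show ?case by simp
  qed
qed

locale sg_left_action = S: semigrp S + M: monoid M
  for S :: "('s, 'c) semigrp_struct_scheme" and M :: "('m, 'd) monoid_scheme" +
  fixes act :: "'s \<Rightarrow> 'm \<Rightarrow> 'm"
  assumes act_closed: "\<lbrakk>s \<in> carrier S; a \<in> carrier M\<rbrakk> \<Longrightarrow> act s a \<in> carrier M"
    and act_one: "s \<in> carrier S \<Longrightarrow> act s \<one>\<^bsub>M\<^esub> = \<one>\<^bsub>M\<^esub>"
    and act_act: "\<lbrakk>s \<in> carrier S; t \<in> carrier S; a \<in> carrier M\<rbrakk>
      \<Longrightarrow> act s (act t a) = act (s \<cdot>\<^bsub>S\<^esub> t) a"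
    and act_mult: "\<lbrakk>s \<in> carrier S; a \<in> carrier M; b \<in> carrier M\<rbrakk>
      \<Longrightarrow> act s (a \<otimes>\<^bsub>M\<^esub> b) = act s a \<otimes>\<^bsub>M\<^esub> act s b"

definition semidirect ::
  "('m, 'd) monoid_scheme \<Rightarrow> ('s, 'c) semigrp_struct_scheme \<Rightarrow> ('s \<Rightarrow> 'm \<Rightarrow> 'm) \<Rightarrow> ('m \<times> 's) semigrp_struct" where
  "semidirect M S act =
     \<lparr>carrier = carrier M \<times> carrier S,
      sg_mult = (\<lambda>(a, s) (b, t). (a \<otimes>\<^bsub>M\<^esub> act s b, s \<cdot>\<^bsub>S\<^esub> t))\<rparr>"

lemma (in sg_left_action) semigrp_semidirect: "semigrp (semidirect M S act)"
  by unfold_locales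
    (auto simp: semidirect_def act_closed act_act[symmetric] act_mult S.sg_closed S.sg_assoc M.m_assoc)

(* The letter x_a is the pair (x, a); a letter x of X is identified with (x, 1). *)
definition alph_M :: "('m, 'd) monoid_scheme \<Rightarrow> 'x set \<Rightarrow> ('x \<times> 'm) set" where
  "alph_M M X = X \<times> carrier M"

fun decor :: "('m, 'd) monoid_scheme \<Rightarrow> 'x list \<Rightarrow> 'm \<Rightarrow> ('x \<times> 'm) list" where
  "decor M [] a = []"
| "decor M (x # w) a = (x, a) # map (\<lambda>y. (y, \<one>\<^bsub>M\<^esub>)) w"

definition rels_M1 ::
  "('m, 'd) monoid_scheme \<Rightarrow> ('x list \<times> 'x list) set \<Rightarrow> (('x \<times> 'm) list \<times> ('x \<times> 'm) list) set" where
  "rels_M1 M R = {(decor M u a, decor M v a) | u v a. (u, v) \<in> R \<and> a \<in> carrier M}"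

definition rels_M2 ::
  "('m, 'd) monoid_scheme \<Rightarrow> ('s \<Rightarrow> 'm \<Rightarrow> 'm) \<Rightarrow> 'x set \<Rightarrow> ('x list \<Rightarrow> 's)
     \<Rightarrow> (('x \<times> 'm) list \<times> ('x \<times> 'm) list) set" where
  "rels_M2 M act X \<phi> =
     {([(x, a), (y, b)], [(x, a \<otimes>\<^bsub>M\<^esub> act (\<phi> [x]) b), (y, \<one>\<^bsub>M\<^esub>)]) | x y a b.
        x \<in> X \<and> y \<in> X \<and> a \<in> carrier M \<and> b \<in> carrier M}"

definition rels_M ::
  "('m, 'd) monoid_scheme \<Rightarrow> ('s \<Rightarrow> 'm \<Rightarrow> 'm) \<Rightarrow> 'x set \<Rightarrow> ('x list \<times> 'x list) set \<Rightarrow> ('x list \<Rightarrow> 's)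
     \<Rightarrow> (('x \<times> 'm) list \<times> ('x \<times> 'm) list) set" where
  "rels_M M act X R \<phi> = rels_M1 M R \<union> rels_M2 M act X \<phi>"

definition phi_M ::
  "('m, 'd) monoid_scheme \<Rightarrow> ('s, 'c) semigrp_struct_scheme \<Rightarrow> ('s \<Rightarrow> 'm \<Rightarrow> 'm) \<Rightarrow> ('x list \<Rightarrow> 's)
     \<Rightarrow> ('x \<times> 'm) list \<Rightarrow> 'm \<times> 's" where
  "phi_M M S act \<phi> = free_ext (semidirect M S act) (\<lambda>(x, a). (a, \<phi> [x]))"

end

(* Modulo rels_M2, the decorations of a word can be collected onto its first letter, so every word
   W is congruent to decor M u a, where u is W without decorations and a is the first component of
   its image. As decor M u a maps to (a, \<phi> u), two words with the same image have normal forms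
   decor M u a and decor M v a with \<phi> u = \<phi> v. Finally, the pairs (u, v) for which decor M u a and
   decor M v a are congruent for all a form a congruence that contains R by rels_M1, hence contains
   the kernel of \<phi>. *)
theory Submission
  imports Defs
begin

section \<open>Congruences and generated congruences\<close>

lemma sg_cong_gen_incl: "R \<subseteq> sg_cong_gen S R"
  by (auto simp: sg_cong_gen_def)

lemma sg_cong_gen_least:
  assumes "sg_congruence S \<rho>" "R \<subseteq> \<rho>"
  shows "sg_cong_gen S R \<subseteq> \<rho>"
  using assms by (auto simp: sg_cong_gen_def)

lemma sg_congruence_mult:
  assumes "sg_congruence S \<rho>" "(a, b) \<in> \<rho>" "(c, d) \<in> \<rho>"
  shows "(a \<cdot>\<^bsub>S\<^esub> c, b \<cdot>\<^bsub>S\<^esub> d) \<in> \<rho>"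
  using assms by (auto simp: sg_congruence_def)

lemma sg_congruence_refl:
  assumes "sg_congruence S \<rho>" "a \<in> carrier S"
  shows "(a, a) \<in> \<rho>"
  using assms by (auto simp: sg_congruence_def equiv_def refl_on_def)

lemma sg_congruence_sym:
  assumes "sg_congruence S \<rho>" "(a, b) \<in> \<rho>"
  shows "(b, a) \<in> \<rho>"
  using assms by (auto simp: sg_congruence_def equiv_def dest: symD)

lemma sg_congruence_trans:
  assumes "sg_congruence S \<rho>" "(a, b) \<in> \<rho>" "(b, c) \<in> \<rho>"
  shows "(a, c) \<in> \<rho>"
  using assms by (auto simp: sg_congruence_def equiv_def dest: transD)

lemma (in semigrp) sg_congruence_kernel:
  assumes "h \<in> sg_hom S T"
  shows "sg_congruence S (sg_kernel S h)"
  using assms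
  by (auto simp: sg_congruence_def sg_kernel_def sg_hom_def sg_closed
      intro!: equivI refl_onI symI transI)

section \<open>Words, decorations and products\<close>

lemma sg_mult_free_sg [simp]: "sg_mult (free_sg X) = (@)"
  by (simp add: free_sg_def)

lemma Cons_in_free_sg [simp]: "x # w \<in> carrier (free_sg X) \<longleftrightarrow> x \<in> X \<and> set w \<subseteq> X"
  by (simp add: free_sg_def)

lemma Nil_notin_free_sg [simp]: "[] \<notin> carrier (free_sg X)"
  by (simp add: free_sg_def)

lemma free_sg_hom_Cons:
  assumes "h \<in> sg_hom (free_sg X) T" "x \<in> X" "w \<in> carrier (free_sg X)"
  shows "h (x # w) = h [x] \<cdot>\<^bsub>T\<^esub> h w"
proof -
  have "h ([x] @ w) = h [x] \<cdot>\<^bsub>T\<^esub> h w"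
    using assms by (simp add: sg_hom_def del: append_Cons append_Nil)
  then show ?thesis by simp
qed

lemma free_ext_Cons:
  assumes "w \<noteq> []"
  shows "free_ext T f (x # w) = f x \<cdot>\<^bsub>T\<^esub> free_ext T f w"
  using assms by (cases w) simp_all

text \<open>Only the first letter of a word takes the decoration, so the second factor gets 1
  throughout. For empty \<open>u\<close> the decoration \<open>a\<close> would move to
  \<open>v\<close> on the left and be lost on the right.\<close>

lemma decor_append:
  assumes "u \<noteq> []"
  shows "decor M (u @ v) a = decor M u a @ decor M v \<one>\<^bsub>M\<^esub>"
  using assms by (cases u; cases v) simp_all

lemma (in monoid) decor_in_free_sg:
  assumes "w \<in> carrier (free_sg X)" "a \<in> carrier G"
  shows "decor G w a \<in> carrier (free_sg (alph_M G X))"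
  using assms by (cases w) (auto simp: alph_M_def)

lemma sg_mult_semidirect [simp]:
  "(a, s) \<cdot>\<^bsub>semidirect M S act\<^esub> (b, t) = (a \<otimes>\<^bsub>M\<^esub> act s b, s \<cdot>\<^bsub>S\<^esub> t)"
  by (simp add: semidirect_def)

section \<open>The homomorphism on decorated words\<close>

locale presented_sg_left_action = sg_left_action S M act
  for S :: "('s, 'c) semigrp_struct_scheme"
    and M :: "('m, 'd) monoid_scheme"
    and act :: "'s \<Rightarrow> 'm \<Rightarrow> 'm" +
  fixes X :: "'x set" and R :: "('x list \<times> 'x list) set" and \<phi> :: "'x list \<Rightarrow> 's"
  assumes presentation: "sg_presentation S X R \<phi>"
begin

abbreviation F where "F \<equiv> free_sg (alph_M M X)"
abbreviation RM where "RM \<equiv> rels_M M act X R \<phi>"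
abbreviation \<Phi> where "\<Phi> \<equiv> phi_M M S act \<phi>"

lemma R_subset: "R \<subseteq> carrier (free_sg X) \<times> carrier (free_sg X)"
  and \<phi>_hom: "\<phi> \<in> sg_hom (free_sg X) S"
  and \<phi>_surj: "\<phi> ` carrier (free_sg X) = carrier S"
  and \<phi>_kernel: "sg_kernel (free_sg X) \<phi> = sg_cong_gen (free_sg X) R"
  using presentation by (simp_all add: sg_presentation_def)

lemma \<phi>_closed: "w \<in> carrier (free_sg X) \<Longrightarrow> \<phi> w \<in> carrier S"
  using \<phi>_surj by blast

lemma \<Phi>_hom: "\<Phi> \<in> sg_hom F (semidirect M S act)"
  unfolding phi_M_def
  by (rule semigrp.free_ext_hom[OF semigrp_semidirect])
    (auto simp: alph_M_def semidirect_def \<phi>_closed)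

lemma \<Phi>_single [simp]: "\<Phi> [(x, a)] = (a, \<phi> [x])"
  by (simp add: phi_M_def)

lemma \<Phi>_Cons: "w \<noteq> [] \<Longrightarrow> \<Phi> ((x, a) # w) = (a, \<phi> [x]) \<cdot>\<^bsub>semidirect M S act\<^esub> \<Phi> w"
  by (simp add: phi_M_def free_ext_Cons)

text \<open>Letters after the first contribute only 1 to the monoid component, because each
  \<open>act s\<close> fixes 1. This evaluates normal forms and also supplies the preimages for
  surjectivity.\<close>

lemma \<Phi>_decor:
  assumes "w \<in> carrier (free_sg X)" "a \<in> carrier M"
  shows "\<Phi> (decor M w a) = (a, \<phi> w)"
  using assms
proof (induction w arbitrary: a)
  case (Cons x w)
  show ?case
  proof (cases w)
    case (Cons y v)
    have w: "w \<in> carrier (free_sg X)" and x: "x \<in> X"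
      using Cons Cons.prems by auto
    \<comment> \<open>The undecorated tail is itself a decorated word, with decoration 1, so the
      induction hypothesis applies there; hence the induction is over all \<open>a\<close>.\<close>
    have "decor M (x # w) a = (x, a) # decor M w \<one>\<^bsub>M\<^esub>"
      using Cons by simp
    then have "\<Phi> (decor M (x # w) a) = (a, \<phi> [x]) \<cdot>\<^bsub>semidirect M S act\<^esub> (\<one>\<^bsub>M\<^esub>, \<phi> w)"
      using Cons Cons.IH[OF w M.one_closed] by (simp add: \<Phi>_Cons del: sg_mult_semidirect)
    also have "\<dots> = (a, \<phi> (x # w))"
      using Cons.prems x w by (simp add: act_one \<phi>_closed free_sg_hom_Cons[OF \<phi>_hom])
    finally show ?thesis .
  qed simp
qed simp

section \<open>Soundness of the relations\<close>

lemma RM_subset: "RM \<subseteq> carrier F \<times> carrier F"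
proof -
  have "rels_M1 M R \<subseteq> carrier F \<times> carrier F"
    using R_subset by (auto simp: rels_M1_def intro!: M.decor_in_free_sg)
  moreover have "rels_M2 M act X \<phi> \<subseteq> carrier F \<times> carrier F"
    by (auto simp: rels_M2_def alph_M_def act_closed \<phi>_closed)
  ultimately show ?thesis by (simp add: rels_M_def)
qed

text \<open>Containment of the relations in pairs of nonempty words is essential: otherwise the
  intersection defining the generated relation would run over no congruence at all.\<close>

lemma cong_RM: "sg_congruence F (sg_cong_gen F RM)"
  by (rule semigrp.sg_congruence_cong_gen[OF semigrp_free_sg RM_subset])

lemma RM_subset_kernel: "RM \<subseteq> sg_kernel F \<Phi>"
proof -
  have "\<Phi> u = \<Phi> v" if uv: "(u, v) \<in> rels_M1 M R" for u v
  proof -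
    obtain u' v' a where *: "u = decor M u' a" "v = decor M v' a" "(u', v') \<in> R" "a \<in> carrier M"
      using uv by (auto simp: rels_M1_def)
    then have "(u', v') \<in> sg_kernel (free_sg X) \<phi>"
      unfolding \<phi>_kernel using sg_cong_gen_incl by blast
    then show ?thesis using * by (simp add: sg_kernel_def \<Phi>_decor)
  qed
  \<comment> \<open>Both sides multiply out to first component \<open>a\<close> times
    \<open>act (\<phi> [x]) b\<close>; on the right the extra factor \<open>act (\<phi> [x])\<close>
    of 1 vanishes by \<open>act_one\<close>.\<close>
  moreover have "\<Phi> u = \<Phi> v" if "(u, v) \<in> rels_M2 M act X \<phi>" for u v
    using that by (auto simp: rels_M2_def \<Phi>_Cons act_closed act_one \<phi>_closed)
  ultimately show ?thesis
    using RM_subset by (auto simp: sg_kernel_def rels_M_def)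
qed

section \<open>Lifting the kernel of \<phi> and collecting decorations\<close>

lemma decor_cong:
  assumes "(u, v) \<in> sg_kernel (free_sg X) \<phi>" "a \<in> carrier M"
  shows "(decor M u a, decor M v a) \<in> sg_cong_gen F RM"
proof -
  \<comment> \<open>The quantifier over all decorations belongs inside \<open>\<rho>\<close>:
    closure under products uses the first pair at \<open>a\<close> but the second pair at 1, so a
    fixed \<open>a\<close> would not give a congruence.\<close>
  define \<rho> where "\<rho> = {(u, v). u \<in> carrier (free_sg X) \<and> v \<in> carrier (free_sg X) \<and>
    (\<forall>a\<in>carrier M. (decor M u a, decor M v a) \<in> sg_cong_gen F RM)}"
  have "equiv (carrier (free_sg X)) \<rho>"
  proof (rule equivI)
    show "\<rho> \<subseteq> carrier (free_sg X) \<times> carrier (free_sg X)"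
      by (auto simp: \<rho>_def)
    show "refl_on (carrier (free_sg X)) \<rho>"
      by (rule refl_onI) (auto simp: \<rho>_def intro: sg_congruence_refl[OF cong_RM] M.decor_in_free_sg)
    show "sym \<rho>"
      by (rule symI) (auto simp: \<rho>_def intro: sg_congruence_sym[OF cong_RM])
    show "trans \<rho>"
      by (rule transI) (auto simp: \<rho>_def intro: sg_congruence_trans[OF cong_RM])
  qed
  moreover have "(u @ u', v @ v') \<in> \<rho>" if "(u, v) \<in> \<rho>" "(u', v') \<in> \<rho>" for u v u' v'
  proof -
    have "u @ u' \<in> carrier (free_sg X)" "v @ v' \<in> carrier (free_sg X)" "u \<noteq> []" "v \<noteq> []"
      using that by (auto simp: \<rho>_def free_sg_def)
    moreover have "(decor M u a @ decor M u' \<one>\<^bsub>M\<^esub>, decor M v a @ decor M v' \<one>\<^bsub>M\<^esub>)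
        \<in> sg_cong_gen F RM" if "a \<in> carrier M" for a
      using sg_congruence_mult[OF cong_RM, of "decor M u a" "decor M v a"]
        \<open>(u, v) \<in> \<rho>\<close> \<open>(u', v') \<in> \<rho>\<close> that
      by (simp add: \<rho>_def)
    ultimately show ?thesis by (simp add: \<rho>_def decor_append)
  qed
  ultimately have "sg_congruence (free_sg X) \<rho>"
    by (auto simp: sg_congruence_def)
  moreover have "R \<subseteq> \<rho>"
    using R_subset sg_cong_gen_incl[of RM F] by (fastforce simp: \<rho>_def rels_M_def rels_M1_def)
  ultimately have "sg_cong_gen (free_sg X) R \<subseteq> \<rho>"
    by (rule sg_cong_gen_least)
  then show ?thesis
    using assms by (auto simp: \<phi>_kernel \<rho>_def)
qed

lemma normal_form:
  assumes "W \<in> carrier F"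
  obtains w a where "w \<in> carrier (free_sg X)" "a \<in> carrier M"
    "(W, decor M w a) \<in> sg_cong_gen F RM"
  using assms
proof (induction W arbitrary: thesis)
  case (Cons p W)
  obtain x a where p: "p = (x, a)" "x \<in> X" "a \<in> carrier M"
    using Cons.prems(2) by (auto simp: alph_M_def)
  show ?case
  proof (cases "W = []")
    case True
    then have "(p # W, decor M [x] a) \<in> sg_cong_gen F RM"
      using sg_congruence_refl[OF cong_RM Cons.prems(2)] p by simp
    then show ?thesis
      using Cons.prems(1)[of "[x]" a] p by simp
  next
    case False
    then have W: "W \<in> carrier F"
      using Cons.prems(2) by (simp add: free_sg_def)
    obtain w b where w: "w \<in> carrier (free_sg X)" "b \<in> carrier M"
      and Ww: "(W, decor M w b) \<in> sg_cong_gen F RM"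
      using Cons.IH W by blast
    obtain y v where v: "w = y # v" using w(1) by (cases w) simp_all
    \<comment> \<open>The tail is already normalised, with its decoration \<open>b\<close> on its
      first letter \<open>y\<close>. One relation of \<open>rels_M2\<close> moves \<open>b\<close>
      left across \<open>x\<close>, which turns it into \<open>act (\<phi> [x]) b\<close> and leaves
      1 on \<open>y\<close>.\<close>
    let ?c = "a \<otimes>\<^bsub>M\<^esub> act (\<phi> [x]) b"
    let ?v = "map (\<lambda>y. (y, \<one>\<^bsub>M\<^esub>)) v"
    have c: "?c \<in> carrier M"
      using p w(2) by (simp add: act_closed \<phi>_closed)
    have "([p], [p]) \<in> sg_cong_gen F RM"
      using Cons.prems(2) by (intro sg_congruence_refl[OF cong_RM]) simp
    from sg_congruence_mult[OF cong_RM this Ww]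
    have 1: "(p # W, [(x, a), (y, b)] @ ?v) \<in> sg_cong_gen F RM"
      using p v by simp
    have "([(x, a), (y, b)], [(x, ?c), (y, \<one>\<^bsub>M\<^esub>)]) \<in> rels_M2 M act X \<phi>"
      using p w v by (auto simp: rels_M2_def)
    then have 2: "([(x, a), (y, b)], [(x, ?c), (y, \<one>\<^bsub>M\<^esub>)]) \<in> sg_cong_gen F RM"
      using sg_cong_gen_incl[of RM F] by (auto simp: rels_M_def)
    have "([(x, a), (y, b)] @ ?v, [(x, ?c), (y, \<one>\<^bsub>M\<^esub>)] @ ?v) \<in> sg_cong_gen F RM"
    \<comment> \<open>The empty word is not in the free semigroup, so multiplying the relation on
      the right by \<open>?v\<close> makes sense only for nonempty \<open>v\<close>.\<close>
    proof (cases "v = []")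
      case True
      then show ?thesis using 2 by simp
    next
      case False
      then have "?v \<in> carrier F"
        using w v by (auto simp: free_sg_def alph_M_def)
      from sg_congruence_mult[OF cong_RM 2 sg_congruence_refl[OF cong_RM this]]
      show ?thesis by simp
    qed
    from sg_congruence_trans[OF cong_RM 1 this]
    have "(p # W, decor M (x # w) ?c) \<in> sg_cong_gen F RM"
      using v by simp
    moreover have "x # w \<in> carrier (free_sg X)"
      using p w v by simp
    ultimately show ?thesis using Cons.prems(1) c by blast
  qed
qed simp

section \<open>Equality of kernel and congruence, surjectivity\<close>

lemma cong_gen_subset_kernel: "sg_cong_gen F RM \<subseteq> sg_kernel F \<Phi>"
  by (rule sg_cong_gen_least[OF semigrp.sg_congruence_kernel[OF semigrp_free_sg \<Phi>_hom]
        RM_subset_kernel])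

lemma kernel_subset_cong_gen: "sg_kernel F \<Phi> \<subseteq> sg_cong_gen F RM"
proof (rule subrelI)
  fix U V
  assume UV: "(U, V) \<in> sg_kernel F \<Phi>"
  then have "U \<in> carrier F" "V \<in> carrier F" by (simp_all add: sg_kernel_def)
  then obtain u a v b where u: "u \<in> carrier (free_sg X)" "a \<in> carrier M"
      and U: "(U, decor M u a) \<in> sg_cong_gen F RM"
      and v: "v \<in> carrier (free_sg X)" "b \<in> carrier M"
      and V: "(V, decor M v b) \<in> sg_cong_gen F RM"
    by (metis normal_form)
  \<comment> \<open>By the inclusion already proved, congruent words have equal images, so the
    images of \<open>U\<close> and \<open>V\<close> can be read off their normal forms.\<close>
  have "\<Phi> U = (a, \<phi> u)" "\<Phi> V = (b, \<phi> v)"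
    using U V u v cong_gen_subset_kernel by (auto simp: sg_kernel_def \<Phi>_decor)
  moreover have "\<Phi> U = \<Phi> V" using UV by (simp add: sg_kernel_def)
  ultimately have "a = b" "(u, v) \<in> sg_kernel (free_sg X) \<phi>"
    using u v by (simp_all add: sg_kernel_def)
  then have "(decor M u a, decor M v b) \<in> sg_cong_gen F RM"
    using u decor_cong by simp
  then show "(U, V) \<in> sg_cong_gen F RM"
    using U V by (meson cong_RM sg_congruence_trans sg_congruence_sym)
qed

lemma \<Phi>_surj: "\<Phi> ` carrier F = carrier (semidirect M S act)"
proof
  show "\<Phi> ` carrier F \<subseteq> carrier (semidirect M S act)"
    using \<Phi>_hom by (auto simp: sg_hom_def)
  show "carrier (semidirect M S act) \<subseteq> \<Phi> ` carrier F"
  proof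
    fix p
    assume "p \<in> carrier (semidirect M S act)"
    then obtain a s where p: "p = (a, s)" "a \<in> carrier M" "s \<in> carrier S"
      by (auto simp: semidirect_def)
    moreover obtain w where "w \<in> carrier (free_sg X)" "s = \<phi> w"
      using p(3) \<phi>_surj by blast
    ultimately have "p = \<Phi> (decor M w a)" "decor M w a \<in> carrier F"
      by (simp_all add: \<Phi>_decor M.decor_in_free_sg)
    then show "p \<in> \<Phi> ` carrier F" by blast
  qed
qed

end

theorem theorem3p1:
  fixes S :: "('s, 'c) semigrp_struct_scheme"
    and M :: "('m, 'd) monoid_scheme"
    and act :: "'s \<Rightarrow> 'm \<Rightarrow> 'm"
    and X :: "'x set"
    and R :: "('x list \<times> 'x list) set"
    and \<phi> :: "'x list \<Rightarrow> 's"
  assumes "semigrp S"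
    and "monoid M"
    and "sg_left_action S M act"
    and "sg_presentation S X R \<phi>"
  shows "sg_presentation (semidirect M S act) (alph_M M X) (rels_M M act X R \<phi>) (phi_M M S act \<phi>)"
proof -
  interpret presented_sg_left_action S M act X R \<phi>
    using assms(3,4)
    by (simp add: presented_sg_left_action_def presented_sg_left_action_axioms_def)
  show ?thesis
    unfolding sg_presentation_def
    using RM_subset \<Phi>_hom \<Phi>_surj cong_gen_subset_kernel kernel_subset_cong_gen by blast
qed

end
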